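(* Let $\mathcal{C}$ be a finite acyclic category which is weakly word-embeddable, and let $B\subseteq\mathrm{Ob}(\mathcal{C})$ be a winning set. Then there exist a word $w$ over the alphabet $\Sigma=B$ and a weak embedding $\mathcal{C}\to\mathrm{Sub}_w$. Moreover, $w$ can be taken to have length $$\sum_{b\in B}\max_{c\in\mathrm{Ob}(\mathcal{C})}|\mathrm{Hom}(b,c)|.$$
   Context: A finite category has finitely many objects and morphisms. A small category $\mathcal{C}$ is acyclic if for all distinct objects $c\neq d$, $\mathrm{Hom}(c,d)\neq\varnothing$ implies $\mathrm{Hom}(d,c)=\varnothing$, and $\mathrm{Hom}(c,c)=\{\mathrm{id}_c\}$ for every object $c$. A functor is a weak embedding if it is faithful and injective on objects. An alphabet is a set $\Sigma$. A word of length $n$ over $\Sigma$ is a function $w\colon[n]\to\Sigma$, where $[n]=\{1,\dots,n\}$ and $[0]=\varnothing$. For words $w\colon[n]\to\Sigma$ and $w'\colon[m]\to\Sigma$, a subword inclusion $w'\to w$ is an injective order-preserving map $f\colon[m]\to[n]$ such that $w\circ f=w'$. $\mathrm{Word}(\Sigma)$ is the category of all words over $\Sigma$ with subword inclusions as morphisms. For a word $w$, $\mathrm{Sub}_w$ is the full subcategory of $\mathrm{Word}(\Sigma)$ spanned by all words that admit a morphism into $w$. $\mathcal{C}$ is weakly word-embeddable if there exist an alphabet $\Sigma$, a word $w$ over $\Sigma$ and a weak embedding $\mathcal{C}\to\mathrm{Sub}_w$. Winning sets are defined by the following query game with test set $B\subseteq\mathrm{Ob}(\mathcal{C})$: one player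 secretly chooses a morphism $f\colon x\to y$; the opponent is first told $|\mathrm{Hom}(b,x)|$ and $|\mathrm{Hom}(b,y)|$ for each $b\in B$, and these data must determine $x$ and $y$; then the opponent is told $f\circ h$ for each $b\in B$ and each $h\colon b\to x$, and must determine $f$. Explicitly, $B$ is winning if for all morphisms $f\colon x\to y$ and $f'\colon x'\to y'$ of $\mathcal{C}$: (i) if $|\mathrm{Hom}(b,x)|=|\mathrm{Hom}(b,x')|$ and $|\mathrm{Hom}(b,y)|=|\mathrm{Hom}(b,y')|$ for all $b\in B$, then $x=x'$ and $y=y'$; and (ii) if $x=x'$, $y=y'$ and $f\circ h=f'\circ h$ for all $b\in B$ and all $h\colon b\to x$, then $f=f'$. *)

theory Defs
  imports "HOL-Library.FuncSet"
begin

text \<open>Composition is in applicative order: \<open>Comp C g f\<close> means ``first \<open>f\<close>, then \<open>g\<close>''.\<close>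

record ('o, 'm) cat =
  Ob :: "'o set"
  Arr :: "'m set"
  Dom :: "'m \<Rightarrow> 'o"
  Cod :: "'m \<Rightarrow> 'o"
  Ident :: "'o \<Rightarrow> 'm"
  Comp :: "'m \<Rightarrow> 'm \<Rightarrow> 'm"

definition Hom :: "('o, 'm) cat \<Rightarrow> 'o \<Rightarrow> 'o \<Rightarrow> 'm set" where
  "Hom C x y = {f \<in> Arr C. Dom C f = x \<and> Cod C f = y}"

locale category =
  fixes C :: "('o, 'm) cat"
  assumes Dom_in_Ob: "f \<in> Arr C \<Longrightarrow> Dom C f \<in> Ob C"
    and Cod_in_Ob: "f \<in> Arr C \<Longrightarrow> Cod C f \<in> Ob C"
    and Ident_in_Hom: "x \<in> Ob C \<Longrightarrow> Ident C x \<in> Hom C x x"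
    and Comp_in_Hom: "f \<in> Hom C x y \<Longrightarrow> g \<in> Hom C y z \<Longrightarrow> Comp C g f \<in> Hom C x z"
    and Comp_Ident_right: "f \<in> Hom C x y \<Longrightarrow> Comp C f (Ident C x) = f"
    and Comp_Ident_left: "f \<in> Hom C x y \<Longrightarrow> Comp C (Ident C y) f = f"
    and Comp_assoc: "f \<in> Hom C x y \<Longrightarrow> g \<in> Hom C y z \<Longrightarrow> h \<in> Hom C z u \<Longrightarrow>
      Comp C h (Comp C g f) = Comp C (Comp C h g) f"

locale finite_category = category +
  assumes finite_Ob: "finite (Ob C)"
    and finite_Arr: "finite (Arr C)"

definition acyclic_category :: "('o, 'm) cat \<Rightarrow> bool" where
  "acyclic_category C \<longleftrightarrow>
    (\<forall>c\<in>Ob C. \<forall>d\<in>Ob C. c \<noteq> d \<longrightarrow> Hom C c d \<noteq> {} \<longrightarrow> Hom C d c = {}) \<and>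
    (\<forall>c\<in>Ob C. Hom C c c = {Ident C c})"

definition full_subcategory :: "('o, 'm) cat \<Rightarrow> 'o set \<Rightarrow> ('o, 'm) cat" where
  "full_subcategory C S =
    C\<lparr>Ob := Ob C \<inter> S, Arr := {f \<in> Arr C. Dom C f \<in> S \<and> Cod C f \<in> S}\<rparr>"

definition is_functor ::
  "('o, 'm) cat \<Rightarrow> ('p, 'n) cat \<Rightarrow> ('o \<Rightarrow> 'p) \<Rightarrow> ('m \<Rightarrow> 'n) \<Rightarrow> bool" where
  "is_functor C D Fo Fa \<longleftrightarrow>
    (\<forall>x\<in>Ob C. Fo x \<in> Ob D) \<and>
    (\<forall>x\<in>Ob C. \<forall>y\<in>Ob C. \<forall>f\<in>Hom C x y. Fa f \<in> Hom D (Fo x) (Fo y)) \<and>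
    (\<forall>x\<in>Ob C. Fa (Ident C x) = Ident D (Fo x)) \<and>
    (\<forall>x\<in>Ob C. \<forall>y\<in>Ob C. \<forall>z\<in>Ob C. \<forall>f\<in>Hom C x y. \<forall>g\<in>Hom C y z.
      Fa (Comp C g f) = Comp D (Fa g) (Fa f))"

definition weak_embedding ::
  "('o, 'm) cat \<Rightarrow> ('p, 'n) cat \<Rightarrow> ('o \<Rightarrow> 'p) \<Rightarrow> ('m \<Rightarrow> 'n) \<Rightarrow> bool" where
  "weak_embedding C D Fo Fa \<longleftrightarrow>
    is_functor C D Fo Fa \<and>
    (\<forall>x\<in>Ob C. \<forall>y\<in>Ob C. inj_on Fa (Hom C x y)) \<and>
    inj_on Fo (Ob C)"

text \<open>
  Words over \<open>\<Sigma>\<close> are the elements of \<open>lists \<Sigma>\<close>, so positions are numbered from \<open>0\<close>.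
  Position maps are extensional (\<open>undefined\<close> off their domain), which makes equality
  of HOL functions agree with equality of maps between index sets.
\<close>

definition subword_inclusion :: "'s list \<Rightarrow> 's list \<Rightarrow> (nat \<Rightarrow> nat) \<Rightarrow> bool" where
  "subword_inclusion u v f \<longleftrightarrow>
    f \<in> {..<length u} \<rightarrow>\<^sub>E {..<length v} \<and>
    inj_on f {..<length u} \<and>
    mono_on {..<length u} f \<and>
    (\<forall>i<length u. v ! f i = u ! i)"

text \<open>A morphism \<open>u \<rightarrow> v\<close> is a triple \<open>(u, f, v)\<close>, since \<open>f\<close> alone does not
  determine its source and target words.\<close>

type_synonym 's word_arrow = "'s list \<times> (nat \<Rightarrow> nat) \<times> 's list"

definition Word :: "'s set \<Rightarrow> ('s list, 's word_arrow) cat" where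
  "Word \<Sigma> = \<lparr>
    Ob = lists \<Sigma>,
    Arr = {(u, f, v). u \<in> lists \<Sigma> \<and> v \<in> lists \<Sigma> \<and> subword_inclusion u v f},
    Dom = (\<lambda>(u, f, v). u),
    Cod = (\<lambda>(u, f, v). v),
    Ident = (\<lambda>u. (u, \<lambda>i\<in>{..<length u}. i, u)),
    Comp = (\<lambda>(v, g, w) (u, f, v'). (u, compose {..<length u} g f, w))\<rparr>"

definition Sub :: "'s set \<Rightarrow> 's list \<Rightarrow> ('s list, 's word_arrow) cat" where
  "Sub \<Sigma> w = full_subcategory (Word \<Sigma>) {u \<in> Ob (Word \<Sigma>). Hom (Word \<Sigma>) u w \<noteq> {}}"

text \<open>
  HOL cannot quantify existentially over types, so the ambient type \<open>'s\<close> of the alphabet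
  is a parameter. A theorem that assumes \<open>weakly_word_embeddable TYPE('s) C\<close> for a type
  variable \<open>'s\<close> covers alphabets of every type.
\<close>

definition weakly_word_embeddable :: "'s itself \<Rightarrow> ('o, 'm) cat \<Rightarrow> bool" where
  "weakly_word_embeddable _ C \<longleftrightarrow>
    (\<exists>(\<Sigma> :: 's set) w Fo Fa. w \<in> lists \<Sigma> \<and> weak_embedding C (Sub \<Sigma> w) Fo Fa)"

definition winning_set :: "('o, 'm) cat \<Rightarrow> 'o set \<Rightarrow> bool" where
  "winning_set C B \<longleftrightarrow>
    B \<subseteq> Ob C \<and>
    (\<forall>x\<in>Ob C. \<forall>y\<in>Ob C. \<forall>x'\<in>Ob C. \<forall>y'\<in>Ob C. \<forall>f\<in>Hom C x y. \<forall>f'\<in>Hom C x' y'.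
      ((\<forall>b\<in>B. card (Hom C b x) = card (Hom C b x') \<and> card (Hom C b y) = card (Hom C b y'))
        \<longrightarrow> x = x' \<and> y = y') \<and>
      (x = x' \<and> y = y' \<and> (\<forall>b\<in>B. \<forall>h\<in>Hom C b x. Comp C f h = Comp C f' h)
        \<longrightarrow> f = f'))"

lemma full_subcategory_simps:
  "Ob (full_subcategory C S) = Ob C \<inter> S"
  "Arr (full_subcategory C S) = {f \<in> Arr C. Dom C f \<in> S \<and> Cod C f \<in> S}"
  "Dom (full_subcategory C S) = Dom C"
  "Cod (full_subcategory C S) = Cod C"
  "Ident (full_subcategory C S) = Ident C"
  "Comp (full_subcategory C S) = Comp C"
  by (simp_all add: full_subcategory_def)

lemma Hom_full_subcategory:
  "Hom (full_subcategory C S) x y = (if x \<in> S \<and> y \<in> S then Hom C x y else {})"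
  by (auto simp: Hom_def full_subcategory_simps)

lemma category_full_subcategory:
  assumes "category C"
  shows "category (full_subcategory C S)"
proof -
  interpret category C by fact
  show ?thesis
    by standard
      (auto simp: Hom_full_subcategory full_subcategory_simps Dom_in_Ob Cod_in_Ob Ident_in_Hom
        Comp_Ident_left Comp_Ident_right intro: Comp_in_Hom Comp_assoc split: if_splits)
qed

lemma Word_simps:
  "Ob (Word \<Sigma>) = lists \<Sigma>"
  "Arr (Word \<Sigma>) = {(u, f, v). u \<in> lists \<Sigma> \<and> v \<in> lists \<Sigma> \<and> subword_inclusion u v f}"
  "Dom (Word \<Sigma>) (u, f, v) = u"
  "Cod (Word \<Sigma>) (u, f, v) = v"
  "Ident (Word \<Sigma>) u = (u, \<lambda>i\<in>{..<length u}. i, u)"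
  "Comp (Word \<Sigma>) (v, g, w) (u, f, v') = (u, compose {..<length u} g f, w)"
  by (simp_all add: Word_def)

lemma Hom_Word:
  "Hom (Word \<Sigma>) u v =
    (if u \<in> lists \<Sigma> \<and> v \<in> lists \<Sigma> then {(u, f, v) |f. subword_inclusion u v f} else {})"
  by (auto simp: Hom_def Word_simps)

lemma subword_inclusion_ident: "subword_inclusion u u (\<lambda>i\<in>{..<length u}. i)"
  by (auto simp: subword_inclusion_def inj_on_def mono_on_def)

lemma subword_inclusion_compose:
  assumes "subword_inclusion u v f" "subword_inclusion v w g"
  shows "subword_inclusion u w (compose {..<length u} g f)"
proof -
  have f: "f i < length v" if "i < length u" for i
    using assms(1) that by (auto simp: subword_inclusion_def)
  have g: "g i < length w" if "i < length v" for i
    using assms(2) that by (auto simp: subword_inclusion_def)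
  show ?thesis
    using assms f g
    by (auto simp: subword_inclusion_def compose_def inj_on_def mono_on_def)
qed

lemma category_Word: "category (Word \<Sigma>)"
proof
  fix f x y g z h u
  assume "f \<in> Hom (Word \<Sigma>) x y" "g \<in> Hom (Word \<Sigma>) y z" "h \<in> Hom (Word \<Sigma>) z u"
  then show "Comp (Word \<Sigma>) h (Comp (Word \<Sigma>) g f) = Comp (Word \<Sigma>) (Comp (Word \<Sigma>) h g) f"
    by (auto simp: Hom_Word Word_simps compose_def subword_inclusion_def fun_eq_iff
        split: if_splits)
next
  fix f x y assume f: "f \<in> Hom (Word \<Sigma>) x y"
  then obtain p where p: "f = (x, p, y)" "subword_inclusion x y p"
    by (auto simp: Hom_Word split: if_splits)
  have *: "p \<in> {..<length x} \<rightarrow> {..<length y}" "p \<in> extensional {..<length x}"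
    using p(2) by (auto simp: subword_inclusion_def PiE_def)
  show "Comp (Word \<Sigma>) f (Ident (Word \<Sigma>) x) = f" "Comp (Word \<Sigma>) (Ident (Word \<Sigma>) y) f = f"
    using * by (simp_all add: p(1) Word_simps compose_Id Id_compose)
qed (auto simp: Hom_Word subword_inclusion_ident subword_inclusion_compose Word_simps
    split: if_splits)

lemma category_Sub: "category (Sub \<Sigma> w)"
  unfolding Sub_def by (intro category_full_subcategory category_Word)

end

theory Submission
  imports Defs "HOL-Library.List_Lexorder" "HOL-Library.Product_Lexorder"
begin

text \<open>
  Fix a weak embedding \<open>F\<close> of \<open>C\<close> into some \<open>Sub\<close>. For \<open>b \<in> B\<close> and an object \<open>x\<close>, order
  \<open>Hom(b, x)\<close> by comparing the position maps of \<open>F h\<close> lexicographically. Position maps of subword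
  inclusions are strictly increasing, so postcomposition with \<open>f : x \<rightarrow> y\<close> is a strictly increasing
  map \<open>Hom(b, x) \<rightarrow> Hom(b, y)\<close>. Send \<open>x\<close> to the word
  consisting of \<open>|Hom(b\<^sub>1, x)|\<close> letters \<open>b\<^sub>1\<close>, then \<open>|Hom(b\<^sub>2, x)|\<close> letters \<open>b\<^sub>2\<close>, and so on. Its
  positions are the morphisms from \<open>B\<close> to \<open>x\<close>, and \<open>f\<close> acts on them by postcomposition. The two
  winning conditions give injectivity on objects and faithfulness, and the word whose block of
  letters \<open>b\<close> has length \<open>max |Hom(b, c)|\<close> contains all these words.
\<close>

section \<open>Words and position maps of finite labelled linear orders\<close>

definition word_of :: "('a::linorder \<Rightarrow> 's) \<Rightarrow> 'a set \<Rightarrow> 's list" where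
  "word_of lab P = map lab (sorted_list_of_set P)"

text \<open>This is \<open>\<phi>\<close> transported along the increasing enumerations of
  \<open>P\<close> and \<open>Q\<close>. The restriction to \<open>{..<card P}\<close> provides the
  extensionality that \<open>subword_inclusion\<close> demands.\<close>

definition position_map ::
  "'a::linorder set \<Rightarrow> 'b::linorder set \<Rightarrow> ('a \<Rightarrow> 'b) \<Rightarrow> nat \<Rightarrow> nat" where
  "position_map P Q \<phi> = (\<lambda>i\<in>{..<card P}.
    inv_into {..<card Q} (nth (sorted_list_of_set Q)) (\<phi> (sorted_list_of_set P ! i)))"

lemma bij_betw_nth_sorted_list_of_set:
  "finite P \<Longrightarrow> bij_betw (nth (sorted_list_of_set P)) {..<card P} P"
  by (rule bij_betw_nth) auto

lemma nth_sorted_list_of_set_in: "finite P \<Longrightarrow> i < card P \<Longrightarrow> sorted_list_of_set P ! i \<in> P"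
  using bij_betw_nth_sorted_list_of_set by (auto simp: bij_betw_def)

lemma nth_sorted_list_of_set_mono:
  "finite P \<Longrightarrow> i < j \<Longrightarrow> j < card P \<Longrightarrow> sorted_list_of_set P ! i < sorted_list_of_set P ! j"
  using sorted_wrt_nth_less[OF strict_sorted_list_of_set] by (metis length_sorted_list_of_set)

lemma position_map_nth:
  assumes "finite P" "finite Q" "\<phi> \<in> P \<rightarrow> Q" "i < card P"
  shows "position_map P Q \<phi> i < card Q"
    and "sorted_list_of_set Q ! position_map P Q \<phi> i = \<phi> (sorted_list_of_set P ! i)"
proof -
  have "\<phi> (sorted_list_of_set P ! i) \<in> nth (sorted_list_of_set Q) ` {..<card Q}"
    using assms nth_sorted_list_of_set_in bij_betw_nth_sorted_list_of_set[OF assms(2)]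
    by (auto simp: bij_betw_def)
  from inv_into_into[OF this] f_inv_into_f[OF this]
  show "position_map P Q \<phi> i < card Q"
    and "sorted_list_of_set Q ! position_map P Q \<phi> i = \<phi> (sorted_list_of_set P ! i)"
    using assms(4) by (auto simp: position_map_def)
qed

lemma position_map_eqI:
  assumes "finite Q" "i < card P" "j < card Q"
    "sorted_list_of_set Q ! j = \<phi> (sorted_list_of_set P ! i)"
  shows "position_map P Q \<phi> i = j"
  using assms bij_betw_nth_sorted_list_of_set[OF assms(1)]
  by (auto simp: position_map_def bij_betw_def simp flip: assms(4))

lemma length_word_of [simp]: "length (word_of lab P) = card P"
  by (simp add: word_of_def)

text \<open>If positions failed to increase, sortedness of the enumeration of \<open>Q\<close> would
  force \<open>\<phi>\<close> to reverse or merge two elements of \<open>P\<close>. Preservation of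
  labels becomes preservation of letters.\<close>

lemma subword_inclusion_position_map:
  assumes fin: "finite P" "finite Q" and \<phi>: "\<phi> \<in> P \<rightarrow> Q"
    and mono: "strict_mono_on P \<phi>" and lab: "\<And>p. p \<in> P \<Longrightarrow> lab' (\<phi> p) = lab p"
  shows "subword_inclusion (word_of lab P) (word_of lab' Q) (position_map P Q \<phi>)"
proof -
  let ?f = "position_map P Q \<phi>"
  have strict: "?f i < ?f j" if "i < j" "j < card P" for i j
  proof (rule ccontr)
    assume "\<not> ?f i < ?f j"
    then have "sorted_list_of_set Q ! ?f j \<le> sorted_list_of_set Q ! ?f i"
      using position_map_nth[OF fin \<phi>] that
      by (intro sorted_nth_mono) auto
    moreover have "\<phi> (sorted_list_of_set P ! i) < \<phi> (sorted_list_of_set P ! j)"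
      using that fin
      by (intro strict_mono_onD[OF mono] nth_sorted_list_of_set_in nth_sorted_list_of_set_mono) auto
    ultimately show False
      using position_map_nth[OF fin \<phi>] that by auto
  qed
  have "inj_on ?f {..<card P}"
    using strict by (intro linorder_inj_onI) fastforce+
  moreover have "mono_on {..<card P} ?f"
    using strict by (intro mono_onI) (metis lessThan_iff nat_less_le order.refl)
  moreover have "?f \<in> extensional {..<card P}"
    by (simp add: position_map_def)
  ultimately show ?thesis
    using position_map_nth[OF fin \<phi>] nth_sorted_list_of_set_in[OF fin(1)] lab
    by (auto simp: subword_inclusion_def word_of_def PiE_def)
qed

lemma position_map_ident:
  assumes "finite P" "\<And>p. p \<in> P \<Longrightarrow> \<phi> p = p"
  shows "position_map P P \<phi> = (\<lambda>i\<in>{..<card P}. i)"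
proof
  fix i
  show "position_map P P \<phi> i = (\<lambda>i\<in>{..<card P}. i) i"
  proof (cases "i < card P")
    case True
    then show ?thesis
      using assms nth_sorted_list_of_set_in[OF assms(1)] by (auto intro!: position_map_eqI)
  qed (simp add: position_map_def)
qed

text \<open>Together with \<open>position_map_ident\<close>, this supplies functoriality. Agreement
  on \<open>P\<close> suffices because only elements of \<open>P\<close> are enumerated.\<close>

lemma position_map_compose:
  assumes fin: "finite P" "finite Q" "finite R" and \<phi>: "\<phi> \<in> P \<rightarrow> Q" and \<psi>: "\<psi> \<in> Q \<rightarrow> R"
    and \<chi>: "\<And>p. p \<in> P \<Longrightarrow> \<chi> p = \<psi> (\<phi> p)"
  shows "position_map P R \<chi> = compose {..<card P} (position_map Q R \<psi>) (position_map P Q \<phi>)"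
proof
  fix i
  show "position_map P R \<chi> i = compose {..<card P} (position_map Q R \<psi>) (position_map P Q \<phi>) i"
  proof (cases "i < card P")
    case True
    then show ?thesis
      using position_map_nth[OF fin(1,2) \<phi>] position_map_nth[OF fin(2,3) \<psi>]
        nth_sorted_list_of_set_in[OF fin(1)] \<chi> fin
      by (auto simp: compose_def intro!: position_map_eqI)
  qed (simp add: position_map_def[of P] compose_def)
qed

lemma position_map_eqD:
  assumes fin: "finite P" "finite Q" and "\<phi> \<in> P \<rightarrow> Q" "\<psi> \<in> P \<rightarrow> Q"
    and eq: "position_map P Q \<phi> = position_map P Q \<psi>" and "p \<in> P"
  shows "\<phi> p = \<psi> p"
proof -
  obtain i where "i < card P" "p = sorted_list_of_set P ! i"
    using bij_betw_nth_sorted_list_of_set[OF fin(1)] \<open>p \<in> P\<close> by (auto simp: bij_betw_def)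
  then show ?thesis
    using position_map_nth(2)[OF fin] assms by metis
qed

text \<open>Both sides count the occurrences of the letter \<open>b\<close> in the same word. This
  lets the numbers |Hom(b, x)| be read off from the word of x.\<close>

lemma card_label_eq:
  assumes "finite P" "finite Q" "word_of lab P = word_of lab' Q"
  shows "card {p \<in> P. lab p = b} = card {q \<in> Q. lab' q = b}"
proof -
  have "length (filter (\<lambda>c. c = b) (word_of l S)) = card {p \<in> S. l p = b}"
    if "finite S" for l :: "'x::linorder \<Rightarrow> 'c" and S b
    using that distinct_card[of "filter (\<lambda>p. l p = b) (sorted_list_of_set S)"]
    by (simp add: word_of_def filter_map comp_def)
  then show ?thesis
    using assms by metis
qed

text \<open>The first difference of two lists keeps its direction under \<open>f\<close>, and a
  proper prefix stays a proper prefix. It is applied to postcomposition on codes.\<close>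

lemma map_less_map:
  fixes xs ys :: "'a::linorder list" and f :: "'a \<Rightarrow> 'b::linorder"
  assumes "strict_mono_on A f" "set xs \<subseteq> A" "set ys \<subseteq> A" "xs < ys"
  shows "map f xs < map f ys"
  using assms(2-4)
proof (induction xs arbitrary: ys)
  case Nil
  then show ?case by (cases ys) auto
next
  case (Cons x xs)
  then show ?case
    using strict_mono_onD[OF assms(1)] by (cases ys) auto
qed

lemma subword_inclusion_strict_mono_on:
  "subword_inclusion u v f \<Longrightarrow> strict_mono_on {..<length u} f"
  by (intro strict_mono_onI)
    (metis inj_onD less_imp_le mono_onD order.not_eq_order_implies_strict order.strict_iff_not
      subword_inclusion_def)

lemma Hom_Sub: "a \<in> Hom (Sub \<Sigma> w) u v \<longleftrightarrow> (\<exists>f. a = (u, f, v) \<and> subword_inclusion u v f) \<and>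
    u \<in> lists \<Sigma> \<and> v \<in> lists \<Sigma> \<and> Hom (Word \<Sigma>) u w \<noteq> {} \<and> Hom (Word \<Sigma>) v w \<noteq> {}"
  by (auto simp: Sub_def Hom_full_subcategory Hom_Word Word_simps)

theorem theorem6p4:
  fixes C :: "('o, 'm) cat" and B :: "'o set"
  assumes "finite_category C"
    and "acyclic_category C"
    and "weakly_word_embeddable TYPE('s) C"
    and "winning_set C B"
  shows "\<exists>w Fo Fa. w \<in> lists B \<and> weak_embedding C (Sub B w) Fo Fa \<and>
    length w = (\<Sum>b\<in>B. Max ((\<lambda>c. card (Hom C b c)) ` Ob C))"
proof -
  interpret finite_category C by fact
  obtain \<Sigma> :: "'s set" and w0 Fo Fa where F: "weak_embedding C (Sub \<Sigma> w0) Fo Fa"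
    using assms(3) by (auto simp: weakly_word_embeddable_def)
  have BC: "B \<subseteq> Ob C"
    using assms(4) by (simp add: winning_set_def)
  then have finB: "finite B"
    using finite_Ob finite_subset by blast
  \<comment> \<open>The objects carry no order, so the blocks of letters are ordered by their
    indices under an arbitrary enumeration.\<close>
  obtain e where e: "bij_betw e {..<card B} B"
    using ex_bij_betw_nat_finite[OF finB] by (auto simp: atLeast0LessThan)
  have eB: "e k \<in> B" "e k \<in> Ob C" if "k < card B" for k
    using e that BC by (auto simp: bij_betw_def)
  have Hom_Ob: "x \<in> Ob C" "y \<in> Ob C" if "f \<in> Hom C x y" for f x y
    using that Dom_in_Ob Cod_in_Ob by (auto simp: Hom_def)
  have finHom: "finite (Hom C x y)" for x y
    using finite_Arr by (simp add: Hom_def)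

  \<comment> \<open>Position maps of the given embedding and their codes\<close>
  define pos where "pos f = fst (snd (Fa f))" for f
  have F_Hom: "Fa f = (Fo x, pos f, Fo y)" "subword_inclusion (Fo x) (Fo y) (pos f)"
    if "f \<in> Hom C x y" for f x y
  proof -
    have "Fa f \<in> Hom (Sub \<Sigma> w0) (Fo x) (Fo y)"
      using F that Hom_Ob[OF that] by (simp add: weak_embedding_def is_functor_def)
    then show "Fa f = (Fo x, pos f, Fo y)" "subword_inclusion (Fo x) (Fo y) (pos f)"
      by (auto simp: Hom_Sub pos_def)
  qed
  have F_faithful: "f = g" if "f \<in> Hom C x y" "g \<in> Hom C x y" "pos f = pos g" for f g x y
  proof -
    have "inj_on Fa (Hom C x y)"
      using F Hom_Ob[OF that(1)] by (simp add: weak_embedding_def)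
    then show ?thesis
      using F_Hom(1)[OF that(1)] F_Hom(1)[OF that(2)] that by (metis inj_onD)
  qed
  have pos_Comp: "pos (Comp C g f) = compose {..<length (Fo x)} (pos g) (pos f)"
    if "f \<in> Hom C x y" "g \<in> Hom C y z" for f g x y z
  proof -
    have "Fa (Comp C g f) = Comp (Sub \<Sigma> w0) (Fa g) (Fa f)"
      using F that Hom_Ob[OF that(1)] Hom_Ob[OF that(2)]
      by (auto simp: weak_embedding_def is_functor_def)
    then show ?thesis
      using F_Hom(1)[OF that(1)] F_Hom(1)[OF that(2)]
      by (simp add: pos_def[of "Comp C g f"] Sub_def full_subcategory_simps Word_simps)
  qed

  \<comment> \<open>Functions are ordered only pointwise in HOL; listing the values of
    \<open>pos h\<close> gives an element of a linear order.\<close>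
  define code where "code h = map (pos h) [0..<length (Fo (Dom C h))]" for h
  have code_eq: "code h = map (pos h) [0..<length (Fo b)]" if "h \<in> Hom C b x" for h b x
    using that by (simp add: code_def Hom_def)
  have code_Comp: "code (Comp C f h) = map (pos f) (code h)"
    if "h \<in> Hom C b x" "f \<in> Hom C x y" for f h b x y
    using code_eq[OF that(1)] code_eq[OF Comp_in_Hom[OF that]] pos_Comp[OF that]
    by (simp add: compose_def)
  \<comment> \<open>The code fixes \<open>pos h\<close> on the positions of \<open>Fo b\<close>,
    extensionality fixes it elsewhere, and faithfulness of the embedding recovers
    \<open>h\<close>.\<close>
  have code_inj: "inj_on code (Hom C b x)" for b x
  proof (rule inj_onI)
    fix h h' assume h: "h \<in> Hom C b x" "h' \<in> Hom C b x" "code h = code h'"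
    have "pos h i = pos h' i" if "i < length (Fo b)" for i
      using h(3) that code_eq[OF h(1)] code_eq[OF h(2)] by simp
    moreover have "pos h \<in> extensional {..<length (Fo b)}" "pos h' \<in> extensional {..<length (Fo b)}"
      using F_Hom(2)[OF h(1)] F_Hom(2)[OF h(2)] by (auto simp: subword_inclusion_def PiE_def)
    ultimately have "pos h = pos h'"
      by (auto intro: extensionalityI)
    then show "h = h'"
      using F_faithful h by blast
  qed
  have code_range: "set (code h) \<subseteq> {..<length (Fo x)}" if "h \<in> Hom C b x" for h b x
    using F_Hom(2)[OF that] code_eq[OF that] by (auto simp: subword_inclusion_def)

  \<comment> \<open>A linearly ordered copy of the disjoint union of the sets Hom(b, x): block index
    first, then code.\<close>
  define P where "P x = (SIGMA k:{..<card B}. code ` Hom C (e k) x)" for x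
  define lab :: "nat \<times> nat list \<Rightarrow> 'o" where "lab p = e (fst p)" for p
  define \<phi> :: "'m \<Rightarrow> nat \<times> nat list \<Rightarrow> nat \<times> nat list"
    where "\<phi> f p = (fst p, map (pos f) (snd p))" for f p
  define N where "N k = Max ((\<lambda>c. card (Hom C (e k) c)) ` Ob C)" for k
  define Q where "Q = (SIGMA k:{..<card B}. {..<N k})"
  define lab' :: "nat \<times> nat \<Rightarrow> 'o" where "lab' p = e (fst p)" for p
  define w where "w = word_of lab' Q"
  define Go where "Go x = word_of lab (P x)" for x
  define Ga where
    "Ga f = (Go (Dom C f), position_map (P (Dom C f)) (P (Cod C f)) (\<phi> f), Go (Cod C f))" for f

  have finP: "finite (P x)" for x
    by (simp add: P_def finHom)
  have finQ: "finite Q"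
    by (simp add: Q_def)
  have Go_B: "Go x \<in> lists B" for x
    using finP[of x] eB by (auto simp: Go_def word_of_def P_def lab_def)
  have w_B: "w \<in> lists B"
    using finQ eB by (auto simp: w_def word_of_def lab'_def Q_def)
  have card_P: "card {p \<in> P x. fst p = k} = card (Hom C (e k) x)" if "k < card B" for x k
  proof -
    have "{p \<in> P x. fst p = k} = Pair k ` code ` Hom C (e k) x"
      using that by (auto simp: P_def)
    then show ?thesis
      using card_image[OF code_inj] by (simp add: card_image inj_on_def)
  qed
  \<comment> \<open>Injectivity of \<open>e\<close> on the indices makes the letter determine the
    block.\<close>
  have lab_P: "{p \<in> P x. lab p = e k} = {p \<in> P x. fst p = k}" if "k < card B" for x k
    using e that by (auto simp: P_def lab_def bij_betw_def inj_on_def)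

  have \<phi>_P: "\<phi> f \<in> P x \<rightarrow> P y" if "f \<in> Hom C x y" for f x y
    using that Comp_in_Hom code_Comp by (force simp: P_def \<phi>_def simp flip: code_Comp)
  have \<phi>_mono: "strict_mono_on (P x) (\<phi> f)" if f: "f \<in> Hom C x y" for f x y
  proof (rule strict_mono_onI)
    fix p q assume pq: "p \<in> P x" "q \<in> P x" "p < q"
    have "set (snd p) \<subseteq> {..<length (Fo x)}" "set (snd q) \<subseteq> {..<length (Fo x)}"
      \<comment> \<open>Entries of codes are positions of \<open>Fo x\<close>, which is where
        \<open>pos f\<close> is strictly increasing.\<close>
      using pq(1,2) code_range by (fastforce simp: P_def)+
    then show "\<phi> f p < \<phi> f q"
      using pq(3) map_less_map[OF subword_inclusion_strict_mono_on[OF F_Hom(2)[OF f]]]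
      by (auto simp: \<phi>_def less_prod_def)
  qed
  have Ga_Hom: "Ga f = (Go x, position_map (P x) (P y) (\<phi> f), Go y)" if "f \<in> Hom C x y" for f x y
    using that by (auto simp: Ga_def Hom_def)
  have Ga_subword: "subword_inclusion (Go x) (Go y) (position_map (P x) (P y) (\<phi> f))"
    if "f \<in> Hom C x y" for f x y
    unfolding Go_def
    using finP \<phi>_P[OF that] \<phi>_mono[OF that]
    by (intro subword_inclusion_position_map) (auto simp: lab_def \<phi>_def)

  \<comment> \<open>The words \<open>Go x\<close> as subwords of \<open>w\<close>\<close>
  have Go_w: "Hom (Word B) (Go x) w \<noteq> {}" if x: "x \<in> Ob C" for x
  proof -
    \<comment> \<open>Each element goes to its rank within its own block. It does not count itself,
      so the rank is below the block size, which is at most \<open>N (fst p)\<close>.\<close>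
    define r where "r p = (fst p, card {q \<in> P x. fst q = fst p \<and> q < p})" for p
    have rank: "card {q \<in> P x. fst q = fst p \<and> q < p} < card {q \<in> P x. fst q = fst p}"
      if "p \<in> P x" for p
      using that finP by (intro psubset_card_mono) auto
    have "card {q \<in> P x. fst q = fst p \<and> q < p} < card {q \<in> P x. fst q = fst p' \<and> q < p'}"
      if "p \<in> P x" "fst p = fst p'" "p < p'" for p p'
      using that finP by (intro psubset_card_mono) auto
    then have "strict_mono_on (P x) r"
      by (intro strict_mono_onI) (auto simp: r_def less_prod_def)
    moreover have "r \<in> P x \<rightarrow> Q"
    proof
      fix p assume p: "p \<in> P x"
      then have k: "fst p < card B" by (auto simp: P_def)
      have "card (Hom C (e (fst p)) x) \<le> N (fst p)"
        using finite_Ob x by (auto simp: N_def)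
      then show "r p \<in> Q"
        using k rank[OF p] card_P[OF k, of x] by (auto simp: r_def Q_def)
    qed
    ultimately have "subword_inclusion (Go x) w (position_map (P x) Q r)"
      unfolding Go_def w_def using finP finQ
      by (intro subword_inclusion_position_map) (auto simp: r_def lab_def lab'_def)
    then show ?thesis
      using Go_B w_B by (auto simp: Hom_Word)
  qed

  \<comment> \<open>In terms of codes, \<open>\<phi> f\<close> is postcomposition with
    \<open>f\<close>.\<close>
  have \<phi>_Comp: "\<phi> f (k, code h) = (k, code (Comp C f h))"
    if "f \<in> Hom C x y" "h \<in> Hom C (e k) x" for f h k x y
    using code_Comp[OF that(2,1)] by (simp add: \<phi>_def)

  \<comment> \<open>Functoriality, faithfulness and injectivity on objects\<close>
  have "is_functor C (Sub B w) Go Ga"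
    unfolding is_functor_def
  proof (intro conjI ballI)
    fix x assume x: "x \<in> Ob C"
    show "Go x \<in> Ob (Sub B w)"
      using Go_B Go_w[OF x] by (simp add: Sub_def full_subcategory_simps Word_simps)
    have "\<phi> (Ident C x) p = p" if "p \<in> P x" for p
      using that \<phi>_Comp[OF Ident_in_Hom[OF x]] Comp_Ident_left by (auto simp: P_def)
    then have "position_map (P x) (P x) (\<phi> (Ident C x)) = (\<lambda>i\<in>{..<card (P x)}. i)"
      by (intro position_map_ident finP)
    then show "Ga (Ident C x) = Ident (Sub B w) (Go x)"
      using Ga_Hom[OF Ident_in_Hom[OF x]]
      by (simp add: Sub_def full_subcategory_simps Word_simps Go_def)
  next
    fix x y f assume "x \<in> Ob C" "y \<in> Ob C" "f \<in> Hom C x y"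
    then show "Ga f \<in> Hom (Sub B w) (Go x) (Go y)"
      using Ga_Hom Ga_subword Go_B Go_w by (simp add: Hom_Sub)
  next
    fix x y z f g assume fg: "f \<in> Hom C x y" "g \<in> Hom C y z"
    have "\<phi> (Comp C g f) p = \<phi> g (\<phi> f p)" if "p \<in> P x" for p
      using that \<phi>_Comp[OF fg(1)] \<phi>_Comp[OF fg(2)] \<phi>_Comp[OF Comp_in_Hom[OF fg]]
        Comp_in_Hom[OF _ fg(1)] Comp_assoc[OF _ fg] by (auto simp: P_def)
    then have "position_map (P x) (P z) (\<phi> (Comp C g f)) = compose {..<card (P x)}
        (position_map (P y) (P z) (\<phi> g)) (position_map (P x) (P y) (\<phi> f))"
      by (intro position_map_compose finP \<phi>_P fg)
    then show "Ga (Comp C g f) = Comp (Sub B w) (Ga g) (Ga f)"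
      using Ga_Hom[OF fg(1)] Ga_Hom[OF fg(2)] Ga_Hom[OF Comp_in_Hom[OF fg]]
      by (simp add: Sub_def full_subcategory_simps Word_simps Go_def)
  qed
  moreover have "inj_on Ga (Hom C x y)" for x y
  proof (rule inj_onI)
    fix f g assume fg: "f \<in> Hom C x y" "g \<in> Hom C x y" "Ga f = Ga g"
    then have eq: "position_map (P x) (P y) (\<phi> f) = position_map (P x) (P y) (\<phi> g)"
      using Ga_Hom by simp
    \<comment> \<open>The position map determines \<open>\<phi> f\<close> on \<open>P x\<close>,
      hence the codes of all composites with morphisms from \<open>B\<close>. Winning condition (ii)
      then identifies \<open>f\<close> and \<open>g\<close>.\<close>
    have "Comp C f h = Comp C g h" if "b \<in> B" and h: "h \<in> Hom C b x" for b h
    proof -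
      obtain k where k: "k < card B" "b = e k"
        using e \<open>b \<in> B\<close> by (auto simp: bij_betw_def)
      have "(k, code h) \<in> P x"
        using k h by (auto simp: P_def)
      then have "\<phi> f (k, code h) = \<phi> g (k, code h)"
        by (intro position_map_eqD[OF finP finP \<phi>_P[OF fg(1)] \<phi>_P[OF fg(2)] eq])
      then have "code (Comp C f h) = code (Comp C g h)"
        using \<phi>_Comp fg h k by auto
      then show ?thesis
        using inj_onD[OF code_inj] Comp_in_Hom[OF h fg(1)] Comp_in_Hom[OF h fg(2)] by blast
    qed
    then show "f = g"
      using assms(4) fg(1,2) Hom_Ob[OF fg(1)] unfolding winning_set_def by blast
  qed
  moreover have "inj_on Go (Ob C)"
  proof (rule inj_onI)
    fix x y assume xy: "x \<in> Ob C" "y \<in> Ob C" "Go x = Go y"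
    have "card (Hom C b x) = card (Hom C b y)" if "b \<in> B" for b
    proof -
      obtain k where k: "k < card B" "b = e k"
        using e \<open>b \<in> B\<close> by (auto simp: bij_betw_def)
      show ?thesis
        using card_label_eq[OF finP finP xy(3)[unfolded Go_def], of b] lab_P card_P k by simp
    qed
    \<comment> \<open>Winning condition (i) speaks of morphisms; it is applied to the identities of
      \<open>x\<close> and \<open>y\<close>.\<close>
    then show "x = y"
      using assms(4) xy(1,2) Ident_in_Hom unfolding winning_set_def by blast
  qed
  ultimately have "weak_embedding C (Sub B w) Go Ga"
    by (simp add: weak_embedding_def)
  moreover have "length w = (\<Sum>b\<in>B. Max ((\<lambda>c. card (Hom C b c)) ` Ob C))"
    \<comment> \<open>The size of \<open>Q\<close> is the sum of \<open>N k\<close> over the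
      indices, which \<open>e\<close> turns into a sum over \<open>B\<close>.\<close>
    using sum.reindex_bij_betw[OF e, of "\<lambda>b. Max ((\<lambda>c. card (Hom C b c)) ` Ob C)"]
    by (simp add: w_def Q_def N_def)
  ultimately show ?thesis
    using w_B by blast
qed

end
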